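(* Let $c\in\mathbb{Z}_+$ and let $C_1^k\subseteq V_1$, $C_2^k\subseteq V_2$, $k=1,\dots,c$, be such that $|C_1^k|\ge2$ for each $k$; for each $k$ there is $n_\omega(C_1^k)\in\mathbb{Z}_+$ with $|\mathcal{U}_\omega(\{i,j\},V_1\setminus C_1^k)\cap C_2^k|=n_\omega(C_1^k)$ for every pair of distinct nodes $\{i,j\}\subseteq C_1^k$; and $C_2^i\cap C_2^j=\emptyset$ for all $i\neq j$. Then the inequality $$\theta_\omega\le\sum_{k=1}^{c}n_\omega(C_1^k)\Big(1-\sum_{j\in C_1^k}x_j\Big)+\sum_{j\in V_1}\sigma_\omega(\{j\})x_j$$ is facet defining for $\mathrm{conv}(\mathcal{S}_\omega)$ if the following conditions hold: (i) $C_1^i\cap C_1^j=\emptyset$ for all $i,j=1,\dots,c$, $i\ne j$; and (ii) for each $k=1,\dots,c$ there exists at least one pair of distinct nodes $\{i,j\}\subseteq C_1^k$ such that $\mathcal{U}_\omega(\{i,j\},\emptyset)=\mathcal{U}_\omega(\{i,j\},V_1\setminus C_1^k)\subseteq C_2^k$ and $\mathcal{U}_\omega(\{i,r\},\emptyset)=\mathcal{U}_\omega(\{j,r\},\emptyset)=\emptyset$ for all $r\in V_1\setminus C_1^k$.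
   Context: Fix a bipartite directed graph (live-arc graph of scenario $\omega$) $G_\omega=(V_1\cup V_2,E_\omega)$ with $V_1=\{1,\dots,n\}$, $V_2=\{1,\dots,m\}$ and all arcs $(i,j)\in E_\omega$ going from $i\in V_1$ to $j\in V_2$. For $S\subseteq V_1$, $\sigma_\omega(S)$ is the number of nodes $j\in V_2$ such that $(i,j)\in E_\omega$ for some $i\in S$, and for $j\in V_1\setminus S$, $\rho_j^\omega(S)=\sigma_\omega(S\cup\{j\})-\sigma_\omega(S)$. Define $$\mathcal{S}_\omega=\Big\{(\theta_\omega,x)\in\mathbb{R}\times\{0,1\}^n:\ \theta_\omega\le\sigma_\omega(S)+\sum_{j\in V_1\setminus S}\rho_j^\omega(S)x_j\ \ \forall S\subseteq V_1\Big\}.$$ Its convex hull $\mathrm{conv}(\mathcal{S}_\omega)$ has dimension $n+1$. An inequality is facet defining if it is valid for $\mathrm{conv}(\mathcal{S}_\omega)$ and the points of $\mathrm{conv}(\mathcal{S}_\omega)$ satisfying it with equality form a face of dimension $n$. For disjoint $B,N\subseteq V_1$, $\mathcal{U}_\omega(B,N)=\{j\in V_2:(i,j)\in E_\omega\ \forall i\in B;\ (i,j)\notin E_\omega\ \forall i\in N\}$. *)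

theory Defs
  imports "HOL-Analysis.Analysis"
begin

text \<open>
  The live-arc graph is bipartite with arcs \<open>E :: ('n::finite \<times> 'b) set\<close> directed from
  \<open>V\<^sub>1\<close> to \<open>V\<^sub>2\<close>. The side \<open>V\<^sub>1 = {1,...,n}\<close> is the finite type \<open>'n\<close> (so \<open>n = CARD('n)\<close> and \<open>V\<^sub>1 = UNIV\<close>),
  which makes \<open>\<real> \<times> \<real>\<^sup>n\<close> the Euclidean space \<open>real \<times> (real ^ 'n)\<close>; \<open>V\<^sub>2\<close> is an explicit finite set.
\<close>

definition live_sigma :: "'b set \<Rightarrow> ('n \<times> 'b) set \<Rightarrow> 'n set \<Rightarrow> nat" where
  "live_sigma V2 E S = card {j \<in> V2. \<exists>i\<in>S. (i, j) \<in> E}"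

text \<open>Real-valued, so that the difference is not truncated.\<close>

definition live_rho :: "'b set \<Rightarrow> ('n \<times> 'b) set \<Rightarrow> 'n \<Rightarrow> 'n set \<Rightarrow> real" where
  "live_rho V2 E j S = real (live_sigma V2 E (S \<union> {j})) - real (live_sigma V2 E S)"

definition feasible_set :: "'b set \<Rightarrow> ('n::finite \<times> 'b) set \<Rightarrow> (real \<times> (real ^ 'n)) set" where
  "feasible_set V2 E =
    {(\<theta>, x). (\<forall>i. x $ i \<in> {0, 1}) \<and>
      (\<forall>S. \<theta> \<le> real (live_sigma V2 E S) + (\<Sum>j\<in>UNIV - S. live_rho V2 E j S * x $ j))}"

definition common_nodes :: "'b set \<Rightarrow> ('n \<times> 'b) set \<Rightarrow> 'n set \<Rightarrow> 'n set \<Rightarrow> 'b set" where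
  "common_nodes V2 E B N = {j \<in> V2. (\<forall>i\<in>B. (i, j) \<in> E) \<and> (\<forall>i\<in>N. (i, j) \<notin> E)}"

text \<open>
  The inequality \<open>\<theta> \<le> g x\<close> is facet defining for \<open>K\<close>; here \<open>K\<close> is meant to be full-dimensional,
  that is, of dimension \<open>n + 1\<close>, so that facets have dimension \<open>n\<close>.
\<close>

definition facet_defining :: "(real \<times> (real ^ 'n::finite)) set \<Rightarrow> (real ^ 'n \<Rightarrow> real) \<Rightarrow> bool" where
  "facet_defining K g \<longleftrightarrow>
    (\<forall>(\<theta>, x)\<in>K. \<theta> \<le> g x) \<and>
    {(\<theta>, x)\<in>K. \<theta> = g x} face_of K \<and>
    aff_dim {(\<theta>, x)\<in>K. \<theta> = g x} = int CARD('n)"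

end

theory Submission
  imports Defs
begin

text \<open>
  Write \<open>\<sigma>\<close> for the coverage function and \<open>N t\<close> for the set of neighbours of a node \<open>t\<close> of \<open>V2\<close>.
  A node \<open>t\<close> contributes \<open>\<bar>X \<inter> N t\<bar>\<close> to the modular function \<open>\<Sum>j\<in>X. \<sigma> {j}\<close> but only
  \<open>min 1 \<bar>X \<inter> N t\<bar>\<close> to \<open>\<sigma> X\<close>.  So the two differ by the overlap
  \<open>\<Sum>t\<in>V2. (\<bar>X \<inter> N t\<bar> - 1)\<^sup>+\<close> (\<open>sum_live_sigma_singletons\<close>).  As \<open>\<sigma>\<close> is submodular, the largest
  feasible \<open>\<theta>\<close> over the incidence vector of \<open>X\<close> is exactly \<open>\<sigma> X\<close>
  (\<open>incidence_mem_feasible_set_iff\<close>).  At this point the inequality says that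
  \<open>\<Sum>k. \<nu> k * (\<bar>X \<inter> C1 k\<bar> - 1)\<close> is at most the overlap of \<open>X\<close>, and it is tight when both agree.

  Validity holds block by block (\<open>block_overlap_ge\<close>).  Fix \<open>i \<in> X \<inter> C1 k\<close> and consider the nodes of
  \<open>C2 k\<close> that see \<open>i\<close> and nothing outside \<open>C1 k\<close>.  Their overlaps count the pairs of such a
  node with a further neighbour in \<open>X\<close>; every other element of \<open>X \<inter> C1 k\<close> occurs in exactly \<open>\<nu> k\<close>
  pairs.  The sets \<open>C2 k\<close> are disjoint, so nothing is counted twice when the blocks are added.

  For the dimension, let \<open>a k\<close>, \<open>b k\<close> be the pair that condition (ii) provides in \<open>C1 k\<close>, and let
  \<open>A\<close> consist of all the \<open>a k\<close>.  Condition (ii) makes the following sets tight: \<open>A\<close>;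
  \<open>A \<union> {r}\<close> for \<open>r\<close> in no block; \<open>A - {a k} \<union> {r}\<close> for \<open>r \<in> C1 k\<close>; and \<open>A \<union> {b k}\<close>.  The first
  three meet every block once and have no overlap; the last has overlap exactly \<open>\<nu> k\<close>, coming from
  the common neighbours of \<open>a k\<close> and \<open>b k\<close>.  Subtracting the incidence vector of \<open>A\<close> gives \<open>e\<^sub>r\<close>,
  \<open>e\<^sub>r - e\<^bsub>a k\<^esub>\<close> and \<open>e\<^bsub>b k\<^esub>\<close>, where \<open>e\<^sub>r\<close> is the \<open>r\<close>-th unit vector.  With \<open>r = b k\<close> this yields
  \<open>e\<^bsub>a k\<^esub>\<close>, and then every unit vector, so the tight points span all directions and the face has
  dimension \<open>n\<close> (\<open>facet_defining_convex_hullI\<close>).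
\<close>

section \<open>Incidence vectors\<close>

definition incidence_vector :: "'n set \<Rightarrow> real ^ 'n::finite" where
  "incidence_vector X = (\<chi> i. of_bool (i \<in> X))"

lemma incidence_vector_nth [simp]: "incidence_vector X $ i = of_bool (i \<in> X)"
  by (simp add: incidence_vector_def)

lemma sum_incidence_vector:
  fixes X :: "'n::finite set"
  shows "(\<Sum>j\<in>A. f j * incidence_vector X $ j) = (\<Sum>j\<in>A \<inter> X. f j)"
proof -
  have "(\<Sum>j\<in>A. f j * incidence_vector X $ j) = (\<Sum>j\<in>A. if j \<in> X then f j else 0)"
    by (intro sum.cong) auto
  then show ?thesis
    by (simp add: sum.inter_restrict)
qed

lemma inner_incidence_vector:
  fixes x :: "real ^ 'n::finite"
  shows "incidence_vector X \<bullet> x = (\<Sum>j\<in>X. x $ j)"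
  using sum_incidence_vector[of "\<lambda>j. x $ j" X UNIV] by (simp add: inner_vec_def mult.commute)

lemma sum_incidence_vector_card:
  fixes X :: "'n::finite set"
  shows "(\<Sum>j\<in>A. incidence_vector X $ j) = real (card (X \<inter> A))"
  using sum_incidence_vector[of "\<lambda>_. 1" X A] by (simp add: Int_commute)

lemma binary_vector_incidence:
  fixes x :: "real ^ 'n::finite"
  assumes "\<And>i. x $ i \<in> {0, 1}"
  shows "x = incidence_vector {i. x $ i = 1}"
  using assms by (auto simp: vec_eq_iff of_bool_def)

section \<open>A criterion for facets\<close>

text \<open>
  The face is cut out by the hyperplane \<open>\<theta> = \<alpha> + w \<bullet> x\<close>, which bounds its dimension by \<open>n\<close> from
  above.  Projecting away \<open>\<theta>\<close> cannot raise the dimension, so for the lower bound it is enough that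
  the tight \<open>x\<close> alone affinely span the whole space.
\<close>

lemma facet_defining_convex_hullI:
  fixes P :: "(real \<times> (real ^ 'n::finite)) set"
  assumes affine: "\<And>x. g x = \<alpha> + w \<bullet> x"
    and valid: "\<And>\<theta> x. (\<theta>, x) \<in> P \<Longrightarrow> \<theta> \<le> g x"
    and tight: "(g x0, x0) \<in> P"
    and full: "span ((\<lambda>x. x - x0) ` {x. (g x, x) \<in> P}) = UNIV"
  shows "facet_defining (convex hull P) g"
proof -
  define h :: "real \<times> (real ^ 'n)" where "h = (1, - w)"
  have h: "h \<bullet> (\<theta>, x) = \<alpha> \<longleftrightarrow> \<theta> = g x" "h \<bullet> (\<theta>, x) \<le> \<alpha> \<longleftrightarrow> \<theta> \<le> g x" for \<theta> x
    by (auto simp: h_def affine)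
  have "P \<subseteq> {y. h \<bullet> y \<le> \<alpha>}"
    using valid h(2) by fastforce
  then have hull: "convex hull P \<subseteq> {y. h \<bullet> y \<le> \<alpha>}"
    by (simp add: hull_minimal convex_halfspace_le)
  define F where "F = {(\<theta>, x) \<in> convex hull P. \<theta> = g x}"
  have F: "F = convex hull P \<inter> {y. h \<bullet> y = \<alpha>}"
    by (auto simp: F_def simp flip: h(1))
  have face: "F face_of (convex hull P)"
    unfolding F using hull by (intro face_of_Int_supporting_hyperplane_le) auto
  have "aff_dim F \<le> aff_dim {y. h \<bullet> y = \<alpha>}"
    by (rule aff_dim_subset) (auto simp: F)
  also have "\<dots> = int CARD('n)"
    by (simp add: aff_dim_hyperplane h_def zero_prod_def)
  finally have upper: "aff_dim F \<le> int CARD('n)" .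
  define Q where "Q = {x. (g x, x) \<in> P}"
  have "x0 \<in> affine hull Q"
    using tight by (simp add: Q_def hull_inc)
  then have "aff_dim Q = int (dim ((\<lambda>x. x - x0) ` Q))"
    using aff_dim_eq_dim[of x0 Q] by simp
  also have "\<dots> = int CARD('n)"
    using full by (metis Q_def dim_span dim_UNIV DIM_cart DIM_real mult_1_right)
  finally have "int CARD('n) = aff_dim Q" ..
  also have "Q \<subseteq> snd ` F"
    by (force simp: Q_def F_def intro: hull_inc)
  then have "aff_dim Q \<le> aff_dim (snd ` F)"
    by (rule aff_dim_subset)
  also have "\<dots> \<le> aff_dim F"
    by (intro aff_dim_linear_image_le linear_snd)
  finally have "aff_dim F = int CARD('n)"
    using upper by simp
  with face hull show ?thesis
    unfolding facet_defining_def F_def using h(2) by blast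
qed

section \<open>Coverage and overlap\<close>

definition nbhd :: "('n \<times> 'b) set \<Rightarrow> 'b \<Rightarrow> 'n set" where
  "nbhd E t = {i. (i, t) \<in> E}"

text \<open>
  The truncated subtraction matters: a node that \<open>X\<close> does not cover contributes \<open>0\<close>.
\<close>

definition overlap :: "'b set \<Rightarrow> ('n \<times> 'b) set \<Rightarrow> 'n set \<Rightarrow> nat" where
  "overlap V2 E X = (\<Sum>t\<in>V2. card (X \<inter> nbhd E t) - 1)"

lemma live_sigma_nbhd: "live_sigma V2 E X = card {t \<in> V2. X \<inter> nbhd E t \<noteq> {}}"
  by (auto simp: live_sigma_def nbhd_def intro!: arg_cong[where f = card])

lemma sum_live_sigma_singletons:
  fixes E :: "('n::finite \<times> 'b) set"
  assumes "finite V2"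
  shows "(\<Sum>j\<in>X. live_sigma V2 E {j}) = live_sigma V2 E X + overlap V2 E X"
proof -
  have "(\<Sum>j\<in>X. live_sigma V2 E {j}) = (\<Sum>j\<in>X. \<Sum>t\<in>V2. of_bool (j \<in> nbhd E t))"
    using assms by (simp add: live_sigma_nbhd Int_def flip: sum.inter_filter)
  also have "\<dots> = (\<Sum>t\<in>V2. \<Sum>j\<in>X. of_bool (j \<in> nbhd E t))"
    by (rule sum.swap)
  also have "\<dots> = (\<Sum>t\<in>V2. card (X \<inter> nbhd E t))"
    by simp
  also have "\<dots> = (\<Sum>t\<in>V2. of_bool (X \<inter> nbhd E t \<noteq> {}) + (card (X \<inter> nbhd E t) - 1))"
    by (intro sum.cong) (auto simp: card_gt_0_iff Suc_le_eq)
  also have "\<dots> = live_sigma V2 E X + overlap V2 E X"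
    using assms by (simp add: sum.distrib live_sigma_nbhd overlap_def Int_def)
  finally show ?thesis .
qed

text \<open>
  Every node covered by \<open>X\<close> but not by \<open>S\<close> is newly covered by some \<open>j \<in> X - S\<close>, hence counted by
  the marginal value of that \<open>j\<close> at \<open>S\<close>.
\<close>

lemma live_sigma_submodular_bound:
  fixes E :: "('n::finite \<times> 'b) set"
  assumes "finite V2"
  shows "real (live_sigma V2 E X) \<le> real (live_sigma V2 E S) + (\<Sum>j\<in>X - S. live_rho V2 E j S)"
proof -
  define cov where "cov Y = {t \<in> V2. Y \<inter> nbhd E t \<noteq> {}}" for Y
  have fin: "finite (cov Y)" for Y
    using assms by (simp add: cov_def)
  have \<sigma>: "live_sigma V2 E Y = card (cov Y)" for Y
    by (simp add: cov_def live_sigma_nbhd)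
  have \<rho>: "live_rho V2 E j S = real (card (cov {j} - cov S))" for j
  proof -
    have "cov (S \<union> {j}) = cov S \<union> (cov {j} - cov S)"
      by (auto simp: cov_def)
    then have "card (cov (S \<union> {j})) = card (cov S) + card (cov {j} - cov S)"
      using fin by (metis Diff_disjoint card_Un_disjoint finite_Diff)
    then show ?thesis
      by (simp add: live_rho_def \<sigma>)
  qed
  have "cov X \<subseteq> cov S \<union> (\<Union>j\<in>X - S. cov {j} - cov S)"
    by (auto simp: cov_def)
  then have "card (cov X) \<le> card (cov S \<union> (\<Union>j\<in>X - S. cov {j} - cov S))"
    by (intro card_mono) (auto simp: fin)
  also have "\<dots> \<le> card (cov S) + card (\<Union>j\<in>X - S. cov {j} - cov S)"
    by (rule card_Un_le)
  also have "\<dots> \<le> card (cov S) + (\<Sum>j\<in>X - S. card (cov {j} - cov S))"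
    by (intro add_left_mono card_UN_le) simp
  finally show ?thesis
    by (simp add: \<sigma> \<rho> flip: of_nat_sum of_nat_add)
qed

text \<open>
  The constraint for \<open>S = X\<close> reads \<open>\<theta> \<le> \<sigma> X\<close> at the incidence vector of \<open>X\<close>, and submodularity makes
  every other constraint weaker there.
\<close>

lemma incidence_mem_feasible_set_iff:
  fixes E :: "('n::finite \<times> 'b) set"
  assumes "finite V2"
  shows "(\<theta>, incidence_vector X) \<in> feasible_set V2 E \<longleftrightarrow> \<theta> \<le> real (live_sigma V2 E X)"
proof
  assume "(\<theta>, incidence_vector X) \<in> feasible_set V2 E"
  then have "\<theta> \<le> real (live_sigma V2 E X)
      + (\<Sum>j\<in>UNIV - X. live_rho V2 E j X * incidence_vector X $ j)"
    unfolding feasible_set_def by blast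
  also have "\<dots> = real (live_sigma V2 E X)"
    unfolding sum_incidence_vector by (simp add: Diff_Int_distrib2)
  finally show "\<theta> \<le> real (live_sigma V2 E X)" .
next
  assume *: "\<theta> \<le> real (live_sigma V2 E X)"
  have "\<theta> \<le> real (live_sigma V2 E S)
      + (\<Sum>j\<in>UNIV - S. live_rho V2 E j S * incidence_vector X $ j)" for S
    using * live_sigma_submodular_bound[OF assms, of E X S]
    unfolding sum_incidence_vector by (simp add: Int_Diff Diff_eq Int_commute)
  then show "(\<theta>, incidence_vector X) \<in> feasible_set V2 E"
    by (simp add: feasible_set_def)
qed

lemma common_nodes_nbhd:
  "common_nodes V2 E B N = {t \<in> V2. B \<subseteq> nbhd E t \<and> N \<inter> nbhd E t = {}}"
  by (auto simp: common_nodes_def nbhd_def)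

section \<open>The overlap within a block and under insertion\<close>

text \<open>
  Double counting: fix \<open>i \<in> X \<inter> B\<close>, let \<open>T\<close> be the nodes \<open>t\<close> of \<open>D\<close> with \<open>i \<in> N t \<subseteq> B\<close>, and count
  the pairs of \<open>t \<in> T\<close> and \<open>j \<in> X \<inter> N t - {i}\<close>.  Grouped by \<open>t\<close> they give overlaps; grouped
  by \<open>j\<close> they give \<open>n\<close> for each \<open>j\<close>.
\<close>

lemma block_overlap_ge:
  fixes E :: "('n::finite \<times> 'b) set"
  assumes "finite V2" "D \<subseteq> V2"
    and pairs: "\<And>i j. i \<in> B \<Longrightarrow> j \<in> B \<Longrightarrow> i \<noteq> j \<Longrightarrow>
      card (common_nodes V2 E {i, j} (UNIV - B) \<inter> D) = n"
  shows "n * (card (X \<inter> B) - 1) \<le> (\<Sum>t\<in>D. card (X \<inter> nbhd E t) - 1)"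
proof (cases "X \<inter> B = {}")
  case False
  then obtain i where i: "i \<in> X" "i \<in> B" by blast
  have finD: "finite D"
    using assms finite_subset by blast
  define Y where "Y = X \<inter> B - {i}"
  define T where "T = {t \<in> D. i \<in> nbhd E t \<and> nbhd E t \<subseteq> B}"
  have "n * (card (X \<inter> B) - 1) = (\<Sum>j\<in>Y. n)"
    using i by (simp add: Y_def)
  also have "\<dots> = (\<Sum>j\<in>Y. card {t \<in> T. j \<in> nbhd E t})"
  proof (rule sum.cong [OF refl])
    fix j assume "j \<in> Y"
    moreover have "{t \<in> T. j \<in> nbhd E t} = common_nodes V2 E {i, j} (UNIV - B) \<inter> D"
      using assms(2) by (auto simp: T_def common_nodes_nbhd)
    ultimately show "n = card {t \<in> T. j \<in> nbhd E t}"
      using pairs[of i j] i by (auto simp: Y_def)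
  qed
  also have "\<dots> = (\<Sum>j\<in>Y. \<Sum>t\<in>T. of_bool (j \<in> nbhd E t))"
    using finD by (simp add: T_def Int_def)
  also have "\<dots> = (\<Sum>t\<in>T. \<Sum>j\<in>Y. of_bool (j \<in> nbhd E t))"
    by (rule sum.swap)
  also have "\<dots> = (\<Sum>t\<in>T. card (X \<inter> nbhd E t) - 1)"
  proof (rule sum.cong [OF refl])
    fix t assume "t \<in> T"
    then have "Y \<inter> nbhd E t = X \<inter> nbhd E t - {i}" "i \<in> X \<inter> nbhd E t"
      using i by (auto simp: T_def Y_def)
    then show "(\<Sum>j\<in>Y. of_bool (j \<in> nbhd E t)) = card (X \<inter> nbhd E t) - 1"
      by simp
  qed
  also have "\<dots> \<le> (\<Sum>t\<in>D. card (X \<inter> nbhd E t) - 1)"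
    using finD by (intro sum_mono2) (auto simp: T_def)
  finally show ?thesis .
qed simp

lemma overlap_eq_0I:
  fixes E :: "('n::finite \<times> 'b) set"
  assumes "\<And>i j. i \<in> X \<Longrightarrow> j \<in> X \<Longrightarrow> i \<noteq> j \<Longrightarrow> common_nodes V2 E {i, j} {} = {}"
  shows "overlap V2 E X = 0"
proof -
  have "card (X \<inter> nbhd E t) \<le> Suc 0" if "t \<in> V2" for t
    using assms that by (fastforce simp: card_le_Suc0_iff_eq common_nodes_nbhd)
  then show ?thesis
    by (simp add: overlap_def)
qed

text \<open>
  Adding \<open>b\<close> raises the overlap by one for each node that sees \<open>b\<close> and is already covered by \<open>X\<close>.
\<close>

lemma overlap_insert:
  fixes E :: "('n::finite \<times> 'b) set"
  assumes "finite V2" "b \<notin> X"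
  shows "overlap V2 E (insert b X)
    = overlap V2 E X + card (\<Union>i\<in>X. common_nodes V2 E {i, b} {})"
proof -
  have "overlap V2 E (insert b X)
      = (\<Sum>t\<in>V2. (card (X \<inter> nbhd E t) - 1) + of_bool (b \<in> nbhd E t \<and> X \<inter> nbhd E t \<noteq> {}))"
    unfolding overlap_def
    using assms(2) by (intro sum.cong) (auto simp: Int_insert_left card_gt_0_iff Suc_le_eq)
  also have "\<dots> = overlap V2 E X + card {t \<in> V2. b \<in> nbhd E t \<and> X \<inter> nbhd E t \<noteq> {}}"
    using assms(1) by (simp add: sum.distrib overlap_def Int_def)
  also have "{t \<in> V2. b \<in> nbhd E t \<and> X \<inter> nbhd E t \<noteq> {}} = (\<Union>i\<in>X. common_nodes V2 E {i, b} {})"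
    by (auto simp: common_nodes_nbhd)
  finally show ?thesis .
qed

section \<open>The facet\<close>

theorem proposition3p7:
  fixes V2 :: "'b set"
    and E :: "('n::finite \<times> 'b) set"
    and c :: nat
    and C1 :: "nat \<Rightarrow> 'n set"
    and C2 :: "nat \<Rightarrow> 'b set"
    and \<nu> :: "nat \<Rightarrow> nat"
  assumes "finite V2"
    and "E \<subseteq> UNIV \<times> V2"
    and "\<And>k. k \<in> {1..c} \<Longrightarrow> C2 k \<subseteq> V2"
    and "\<And>k. k \<in> {1..c} \<Longrightarrow> card (C1 k) \<ge> 2"
    and "\<And>k i j. k \<in> {1..c} \<Longrightarrow> i \<in> C1 k \<Longrightarrow> j \<in> C1 k \<Longrightarrow> i \<noteq> j \<Longrightarrow>
           card (common_nodes V2 E {i, j} (UNIV - C1 k) \<inter> C2 k) = \<nu> k"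
    and "\<And>k l. k \<in> {1..c} \<Longrightarrow> l \<in> {1..c} \<Longrightarrow> k \<noteq> l \<Longrightarrow> C2 k \<inter> C2 l = {}"
    and "\<And>k l. k \<in> {1..c} \<Longrightarrow> l \<in> {1..c} \<Longrightarrow> k \<noteq> l \<Longrightarrow> C1 k \<inter> C1 l = {}"
    and "\<And>k. k \<in> {1..c} \<Longrightarrow>
           \<exists>i\<in>C1 k. \<exists>j\<in>C1 k. i \<noteq> j \<and>
             common_nodes V2 E {i, j} {} = common_nodes V2 E {i, j} (UNIV - C1 k) \<and>
             common_nodes V2 E {i, j} (UNIV - C1 k) \<subseteq> C2 k \<and>
             (\<forall>r\<in>UNIV - C1 k. common_nodes V2 E {i, r} {} = {} \<and> common_nodes V2 E {j, r} {} = {})"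
  shows "facet_defining (convex hull feasible_set V2 E)
           (\<lambda>x. (\<Sum>k=1..c. real (\<nu> k) * (1 - (\<Sum>j\<in>C1 k. x $ j)))
                 + (\<Sum>j\<in>UNIV. real (live_sigma V2 E {j}) * x $ j))"
proof -
  let ?K = "{1..c}" and ?iv = "incidence_vector :: 'n set \<Rightarrow> real ^ 'n"
  note fin = assms(1) and C2_sub = assms(3) and pairs = assms(5)
    and C2_disj = assms(6) and C1_disj = assms(7)
  define g where "g x = (\<Sum>k=1..c. real (\<nu> k) * (1 - (\<Sum>j\<in>C1 k. x $ j)))
    + (\<Sum>j\<in>UNIV. real (live_sigma V2 E {j}) * x $ j)" for x :: "real ^ 'n"
  define \<alpha> where "\<alpha> = (\<Sum>k\<in>?K. real (\<nu> k))"
  define w :: "real ^ 'n" where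
    "w = (\<Sum>k\<in>?K. - real (\<nu> k) *\<^sub>R ?iv (C1 k)) + (\<chi> j. real (live_sigma V2 E {j}))"
  have affine: "g x = \<alpha> + w \<bullet> x" for x
    by (simp add: g_def \<alpha>_def w_def inner_add_left inner_diff_left inner_sum_left inner_incidence_vector
        inner_vec_def[of "vec_lambda _"] right_diff_distrib sum_subtractf sum_negf)
  have g_iv: "g (?iv X) = real (live_sigma V2 E X) + real (overlap V2 E X)
      - (\<Sum>k\<in>?K. real (\<nu> k) * (real (card (X \<inter> C1 k)) - 1))" for X
  proof -
    have "(\<Sum>j\<in>UNIV. real (live_sigma V2 E {j}) * ?iv X $ j) = real (\<Sum>j\<in>X. live_sigma V2 E {j})"
      unfolding sum_incidence_vector by simp
    then show ?thesis
      unfolding g_def sum_incidence_vector_card sum_live_sigma_singletons [OF fin]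
      by (simp add: right_diff_distrib sum_subtractf)
  qed
  \<comment> \<open>On incidence vectors this is validity, up to replacing the truncated subtraction by the real
    one, which only lowers the left side since a missed block then counts \<open>- \<nu> k\<close>.\<close>
  have overlap_ge: "(\<Sum>k\<in>?K. \<nu> k * (card (X \<inter> C1 k) - 1)) \<le> overlap V2 E X" for X
  proof -
    have "(\<Sum>k\<in>?K. \<nu> k * (card (X \<inter> C1 k) - 1))
        \<le> (\<Sum>k\<in>?K. \<Sum>t\<in>C2 k. card (X \<inter> nbhd E t) - 1)"
      using fin C2_sub pairs by (intro sum_mono block_overlap_ge) auto
    also have "\<dots> = (\<Sum>t\<in>(\<Union>k\<in>?K. C2 k). card (X \<inter> nbhd E t) - 1)"
      using fin C2_sub C2_disj finite_subset by (subst sum.UNION_disjoint) blast+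
    also have "\<dots> \<le> overlap V2 E X"
      unfolding overlap_def using fin C2_sub by (intro sum_mono2) blast+
    finally show ?thesis .
  qed
  have valid: "\<theta> \<le> g x" if "(\<theta>, x) \<in> feasible_set V2 E" for \<theta> x
  proof -
    define X where "X = {i. x $ i = 1}"
    have x: "x = ?iv X"
      unfolding X_def using that
      by (intro binary_vector_incidence) (auto simp: feasible_set_def)
    have "(\<Sum>k\<in>?K. real (\<nu> k) * (real (card (X \<inter> C1 k)) - 1))
        \<le> (\<Sum>k\<in>?K. real (\<nu> k) * real (card (X \<inter> C1 k) - 1))"
      by (intro sum_mono mult_left_mono) auto
    also have "\<dots> = real (\<Sum>k\<in>?K. \<nu> k * (card (X \<inter> C1 k) - 1))"
      by simp
    also have "\<dots> \<le> real (overlap V2 E X)"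
      using overlap_ge[of X] of_nat_le_iff by blast
    finally have "real (live_sigma V2 E X) \<le> g (?iv X)"
      by (simp add: g_iv)
    with that show ?thesis
      by (simp add: x incidence_mem_feasible_set_iff [OF fin])
  qed
  define isolated where "isolated k i j \<longleftrightarrow> i \<in> C1 k \<and> j \<in> C1 k \<and> i \<noteq> j \<and>
      common_nodes V2 E {i, j} {} = common_nodes V2 E {i, j} (UNIV - C1 k) \<and>
      common_nodes V2 E {i, j} (UNIV - C1 k) \<subseteq> C2 k \<and>
      (\<forall>r\<in>UNIV - C1 k. common_nodes V2 E {i, r} {} = {} \<and> common_nodes V2 E {j, r} {} = {})"
    for k i j
  have "\<forall>k\<in>?K. \<exists>i j. isolated k i j"
    unfolding isolated_def using assms(8) by blast
  then obtain a b where isolated: "\<And>k. k \<in> ?K \<Longrightarrow> isolated k (a k) (b k)"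
    by metis
  have a: "a k \<in> C1 k" and b: "b k \<in> C1 k" and ab: "a k \<noteq> b k"
    and a_far: "\<And>r. r \<notin> C1 k \<Longrightarrow> common_nodes V2 E {a k, r} {} = {}"
    and b_far: "\<And>r. r \<notin> C1 k \<Longrightarrow> common_nodes V2 E {b k, r} {} = {}"
    and ab_card: "card (common_nodes V2 E {a k, b k} {}) = \<nu> k" if "k \<in> ?K" for k
    using isolated[OF that] pairs[OF that, of "a k" "b k"]
    by (simp_all add: isolated_def Int_absorb2)
  \<comment> \<open>The base point of the tight points: it meets each block once and its elements have pairwise no
    common neighbour.\<close>
  define A where "A = a ` ?K"
  have same: "k = l" if "k \<in> ?K" "l \<in> ?K" "r \<in> C1 k" "r \<in> C1 l" for k l r
    using C1_disj[of k l] that by blast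
  have A_Int: "A \<inter> C1 k = {a k}" if "k \<in> ?K" for k
    using a same that by (fastforce simp: A_def)
  have A_unique: "i = a k" if "i \<in> A" "k \<in> ?K" "i \<in> C1 k" for i k
    using A_Int[of k] that by blast
  have b_notin: "b k \<notin> A" if "k \<in> ?K" for k
    using A_unique[of "b k" k] b[OF that] ab[OF that] that by auto
  define tight where "tight X \<longleftrightarrow> (g (?iv X), ?iv X) \<in> feasible_set V2 E" for X
  have tightI: "tight X" if "real (overlap V2 E X)
      = (\<Sum>k\<in>?K. real (\<nu> k) * (real (card (X \<inter> C1 k)) - 1))" for X
    using that by (simp add: tight_def g_iv incidence_mem_feasible_set_iff [OF fin])
  \<comment> \<open>Common neighbours with an element of \<open>A\<close> exist only inside the block of that element.\<close>
  have A_far: "common_nodes V2 E {i, r} {} = {}"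
    if i: "i \<in> A" and r: "\<And>k. k \<in> ?K \<Longrightarrow> r \<in> C1 k \<Longrightarrow> i \<noteq> a k" for i r
  proof -
    obtain k where "k \<in> ?K" "i = a k"
      using i by (auto simp: A_def)
    then show ?thesis
      using r[of k] a_far[of k r] by blast
  qed
  have overlap_A: "overlap V2 E A = 0"
  proof (rule overlap_eq_0I)
    fix i j assume "i \<in> A" "j \<in> A" "i \<noteq> j"
    then show "common_nodes V2 E {i, j} {} = {}"
      using A_unique by (intro A_far) blast+
  qed
  have overlap_sub: "overlap V2 E Y = 0" if "Y \<subseteq> A" for Y
  proof -
    have "overlap V2 E Y \<le> overlap V2 E A"
      unfolding overlap_def using that by (intro sum_mono diff_le_mono card_mono) auto
    then show ?thesis by (simp add: overlap_A)
  qed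
  have tight_transversal: "tight X"
    if "overlap V2 E X = 0" "\<And>k. k \<in> ?K \<Longrightarrow> card (X \<inter> C1 k) = 1" for X
    using that by (intro tightI) simp
  have tight_A: "tight A"
    using A_Int overlap_A by (intro tight_transversal) auto
  have tight_outside: "tight (insert r A)" if r: "\<And>k. k \<in> ?K \<Longrightarrow> r \<notin> C1 k" for r
  proof (cases "r \<in> A")
    case True
    then show ?thesis using tight_A by (simp add: insert_absorb)
  next
    case False
    have "common_nodes V2 E {i, r} {} = {}" if "i \<in> A" for i
      using that r by (intro A_far) blast+
    then have "overlap V2 E (insert r A) = 0"
      using False overlap_A by (simp add: overlap_insert [OF fin])
    moreover have "card (insert r A \<inter> C1 k) = 1" if "k \<in> ?K" for k
      using r[OF that] A_Int[OF that] by simp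
    ultimately show ?thesis
      by (intro tight_transversal)
  qed
  have tight_swap: "tight (insert r (A - {a k}))" if k: "k \<in> ?K" and r: "r \<in> C1 k" for r k
  proof (cases "r = a k")
    case True
    then show ?thesis using tight_A k by (simp add: insert_absorb A_def)
  next
    case False
    have "r \<notin> A - {a k}"
      using A_Int[OF k] r by blast
    moreover have "common_nodes V2 E {i, r} {} = {}" if "i \<in> A - {a k}" for i
      using that same[OF k _ r] by (intro A_far) blast+
    ultimately have "overlap V2 E (insert r (A - {a k})) = 0"
      using overlap_sub[of "A - {a k}"] by (simp add: overlap_insert [OF fin])
    moreover have "insert r (A - {a k}) \<inter> C1 l = {if l = k then r else a l}"
      if l: "l \<in> ?K" for l
    proof (cases "l = k")
      case True
      then show ?thesis using A_Int[OF k] r by auto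
    next
      case ne: False
      have "r \<notin> C1 l" "a k \<notin> C1 l"
        using same[OF k l] ne r a[OF k] by blast+
      then have "insert r (A - {a k}) \<inter> C1 l = A \<inter> C1 l"
        by blast
      then show ?thesis using A_Int[OF l] ne by simp
    qed
    ultimately show ?thesis
      by (intro tight_transversal) simp_all
  qed
  \<comment> \<open>The only tight sets with an overlap: \<open>b k\<close> shares neighbours with no element of \<open>A\<close> except
    \<open>a k\<close>, so the overlap \<open>\<nu> k\<close> balances the second element in block \<open>k\<close>.\<close>
  have tight_b: "tight (insert (b k) A)" if k: "k \<in> ?K" for k
  proof -
    have "(\<Union>i\<in>A. common_nodes V2 E {i, b k} {}) = common_nodes V2 E {a k, b k} {}"
    proof -
      have "common_nodes V2 E {i, b k} {} = {}" if "i \<in> A - {a k}" for i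
        using that same[OF k _ b[OF k]] by (intro A_far) blast+
      moreover have "a k \<in> A"
        using k by (simp add: A_def)
      ultimately show ?thesis by blast
    qed
    then have "overlap V2 E (insert (b k) A) = \<nu> k"
      using b_notin[OF k] by (simp add: overlap_insert [OF fin] overlap_A ab_card [OF k])
    moreover have "real (\<nu> l) * (real (card (insert (b k) A \<inter> C1 l)) - 1)
        = (if l = k then real (\<nu> k) else 0)" if l: "l \<in> ?K" for l
    proof (cases "l = k")
      case True
      then have "insert (b k) A \<inter> C1 l = {a k, b k}"
        using A_Int[OF k] b[OF k] by auto
      then show ?thesis using True ab[OF k] by simp
    next
      case False
      then have "insert (b k) A \<inter> C1 l = {a l}"
        using A_Int[OF l] b[OF k] same[OF k l] by blast
      then show ?thesis using False by simp
    qed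
    ultimately show ?thesis
      using k by (intro tightI) simp
  qed
  let ?D = "(\<lambda>x. x - ?iv A) ` {x. (g x, x) \<in> feasible_set V2 E}"
  have in_span: "?iv X - ?iv A \<in> span ?D" if "tight X" for X
    using that by (intro span_base) (auto simp: tight_def)
  have iv_insert: "?iv (insert r X) = axis r 1 + ?iv X" if "r \<notin> X" for r X
    using that by (auto simp: vec_eq_iff axis_def of_bool_def)
  have swap_span: "axis r 1 - axis (a k) 1 \<in> span ?D" if k: "k \<in> ?K" and r: "r \<in> C1 k" for k r
  proof -
    have "?iv A = axis (a k) 1 + ?iv (A - {a k})"
      using iv_insert[of "a k" "A - {a k}"] k by (simp add: A_def insert_absorb)
    moreover have "?iv (insert r (A - {a k})) = axis r 1 + ?iv (A - {a k})"
      using A_Int[OF k] r by (intro iv_insert) blast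
    ultimately show ?thesis
      using in_span[OF tight_swap[OF k r]] by simp
  qed
  \<comment> \<open>The swap alone gives only differences within a block; the extra tight set \<open>A \<union> {b k}\<close> supplies
    one unit vector of the block, and so all of them.\<close>
  have a_span: "axis (a k) 1 \<in> span ?D" if k: "k \<in> ?K" for k
  proof -
    have "axis (b k) 1 \<in> span ?D"
      using in_span[OF tight_b[OF k]] b_notin[OF k] by (simp add: iv_insert)
    from span_diff[OF this swap_span[OF k b[OF k]]] show ?thesis by simp
  qed
  have axis_span: "axis r 1 \<in> span ?D" for r
  proof (cases "\<exists>k\<in>?K. r \<in> C1 k")
    case True
    then obtain k where k: "k \<in> ?K" "r \<in> C1 k" by blast
    from span_add[OF swap_span[OF k] a_span[OF k(1)]] show ?thesis by simp
  next
    case False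
    then have "tight (insert r A)"
      by (intro tight_outside) blast
    moreover have "r \<notin> A"
      using False a by (auto simp only: A_def)
    ultimately show ?thesis
      using in_span[of "insert r A"] by (simp add: iv_insert)
  qed
  have "(Basis :: (real ^ 'n) set) \<subseteq> span ?D"
  proof
    fix v :: "real ^ 'n"
    assume "v \<in> Basis"
    then obtain i where "v = axis i 1"
      by (auto simp: Basis_vec_def)
    then show "v \<in> span ?D"
      using axis_span by blast
  qed
  from span_minimal[OF this subspace_span] have "span ?D = UNIV"
    by (simp only: span_Basis top.extremum_unique)
  then have "facet_defining (convex hull feasible_set V2 E) g"
    using affine valid tight_A by (intro facet_defining_convex_hullI) (simp_all add: tight_def)
  then show ?thesis
    unfolding g_def .
qed

end
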